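(* Let $X\sim N_d(\theta,\sigma^2I_d)$ with $\theta\in\mathbb{R}^d$ unknown and $\sigma^2>0$ known. Let $\beta:[0,\infty)\to[0,\infty)$ be absolutely continuous and strictly increasing, let $m\neq0$, and let $Z\sim\chi^2_d$. Assume that $\mathbb{E}\{\beta(Z)\}<\infty$ and that the expectations $\mathbb{E}(\log\beta(Z))$ and $\mathbb{E}\big((\beta(Z))^{-m}\big)$ exist (are finite). Consider estimating the first-stage loss $$L=\beta\Big(\frac{\|X-\theta\|^2}{\sigma^2}\Big)$$ (incurred by the estimator $\hat\theta_0(X)=X$ of $\theta$) under the second-stage loss $$W(L,\hat L)=\rho_m\Big(\frac{\hat L}{L}\Big),\qquad \rho_m(t)=t^m-m\log t-1 .$$ Then the estimator $$\hat L_{\pi_0}(X)=\Big\{\mathbb{E}\big((\beta(Z))^{-m}\big)\Big\}^{-1/m}$$ (constant in $X$) is a minimax estimator of $L$, and the minimax risk is $$\bar R=m\,\mathbb{E}\big(\log\beta(Z)\big)+\log\mathbb{E}\big((\beta(Z))^{-m}\big).$$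
   Context: An estimator of $L$ is a function $\hat L(X)$ of $X$ with values in $(0,\infty)$. Its frequentist risk is $R(\theta,\hat L)=\mathbb{E}_\theta\big(W(L,\hat L(X))\big)$, where $L=L(\theta,X)$ also depends on $X$. An estimator $\hat L_m(X)$ is minimax if $\sup_{\theta}R(\theta,\hat L_m)=\inf_{\hat L}\sup_{\theta}R(\theta,\hat L)$; this common value is the minimax risk. $\chi^2_d$ is the central chi-square distribution with $d$ degrees of freedom. $\hat L_{\pi_0}$ is the generalized Bayes estimator of $L$ for the uniform prior density $\pi_0(\theta)=1$ on $\mathbb{R}^d$. *)

theory Defs
  imports "HOL-Probability.Probability"
begin

subsection \<open>Distributions\<close>

definition mvn_density :: "real \<Rightarrow> real ^ 'n \<Rightarrow> real ^ 'n \<Rightarrow> real" where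
  "mvn_density \<sigma> \<theta> x =
     exp (- (norm (x - \<theta>))\<^sup>2 / (2 * \<sigma>\<^sup>2)) / sqrt (2 * pi * \<sigma>\<^sup>2) ^ CARD('n)"

definition mvn :: "real \<Rightarrow> real ^ 'n \<Rightarrow> (real ^ 'n) measure" where
  "mvn \<sigma> \<theta> = density lborel (\<lambda>x. ennreal (mvn_density \<sigma> \<theta> x))"

text \<open>The central chi-square distribution with \<open>d\<close> degrees of freedom is the law of the sum of
  squares of \<open>d\<close> independent standard normal variables.\<close>

definition chi_square :: "nat \<Rightarrow> real measure" where
  "chi_square d =
     distr (\<Pi>\<^sub>M i\<in>{..<d}. density lborel (\<lambda>t. ennreal (std_normal_density t))) borel
       (\<lambda>y. \<Sum>i<d. (y i)\<^sup>2)"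

subsection \<open>Absolute continuity of functions\<close>

definition abs_cont_on_interval :: "real \<Rightarrow> real \<Rightarrow> (real \<Rightarrow> real) \<Rightarrow> bool" where
  "abs_cont_on_interval a b f \<longleftrightarrow>
     (\<forall>\<epsilon>>0. \<exists>\<delta>>0. \<forall>(n::nat) (u::nat \<Rightarrow> real) v.
        (\<forall>i<n. a \<le> u i \<and> u i \<le> v i \<and> v i \<le> b) \<longrightarrow>
        disjoint_family_on (\<lambda>i. {u i<..<v i}) {..<n} \<longrightarrow>
        (\<Sum>i<n. v i - u i) < \<delta> \<longrightarrow>
        (\<Sum>i<n. \<bar>f (v i) - f (u i)\<bar>) < \<epsilon>)"

text \<open>On the unbounded half-line, absolute continuity is understood on every compact subinterval;
  the condition with one modulus for all of the half-line would exclude \<open>t\<^sup>2\<close>.\<close>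

definition abs_cont_halfline :: "(real \<Rightarrow> real) \<Rightarrow> bool" where
  "abs_cont_halfline f \<longleftrightarrow> (\<forall>b\<ge>0. abs_cont_on_interval 0 b f)"

subsection \<open>Estimation of a loss\<close>

definition estimator :: "('x::topological_space \<Rightarrow> real) \<Rightarrow> bool" where
  "estimator Lh \<longleftrightarrow> Lh \<in> borel_measurable borel \<and> (\<forall>x. 0 < Lh x)"

text \<open>In the following, \<open>P \<theta>\<close> is the law of the observation, \<open>L \<theta> x\<close> the quantity to be estimated
  and \<open>W L Lh\<close> the loss. Expected losses are extended nonnegative, so that an infinite risk is a
  legitimate value. This is the ordinary expectation whenever the loss is nonnegative almost
  everywhere.\<close>

definition risk ::
  "('t \<Rightarrow> 'x measure) \<Rightarrow> ('t \<Rightarrow> 'x \<Rightarrow> real) \<Rightarrow> (real \<Rightarrow> real \<Rightarrow> real) \<Rightarrow> 't \<Rightarrow> ('x \<Rightarrow> real) \<Rightarrow> ennreal"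
  where "risk P L W \<theta> Lh = (\<integral>\<^sup>+x. ennreal (W (L \<theta> x) (Lh x)) \<partial>P \<theta>)"

definition minimax_risk ::
  "('t \<Rightarrow> 'x::topological_space measure) \<Rightarrow> ('t \<Rightarrow> 'x \<Rightarrow> real) \<Rightarrow> (real \<Rightarrow> real \<Rightarrow> real) \<Rightarrow> ennreal"
  where "minimax_risk P L W = (INF Lh\<in>{Lh. estimator Lh}. SUP \<theta>. risk P L W \<theta> Lh)"

definition is_minimax ::
  "('t \<Rightarrow> 'x::topological_space measure) \<Rightarrow> ('t \<Rightarrow> 'x \<Rightarrow> real) \<Rightarrow> (real \<Rightarrow> real \<Rightarrow> real)
     \<Rightarrow> ('x \<Rightarrow> real) \<Rightarrow> bool"
  where "is_minimax P L W Lh \<longleftrightarrow>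
    estimator Lh \<and> (SUP \<theta>. risk P L W \<theta> Lh) = minimax_risk P L W"

text \<open>For a likelihood \<open>f \<theta> x\<close> and a possibly improper prior density \<open>\<pi>\<close>, the posterior density
  given \<open>x\<close> is \<open>f \<theta> x * \<pi> \<theta>\<close> divided by the marginal of \<open>x\<close>.\<close>

definition marginal ::
  "('t::euclidean_space \<Rightarrow> 'x \<Rightarrow> real) \<Rightarrow> ('t \<Rightarrow> real) \<Rightarrow> 'x \<Rightarrow> ennreal"
  where "marginal f \<pi> x = (\<integral>\<^sup>+\<theta>. ennreal (f \<theta> x * \<pi> \<theta>) \<partial>lborel)"

definition posterior_risk ::
  "('t::euclidean_space \<Rightarrow> 'x \<Rightarrow> real) \<Rightarrow> ('t \<Rightarrow> real) \<Rightarrow> ('t \<Rightarrow> 'x \<Rightarrow> real) \<Rightarrow> (real \<Rightarrow> real \<Rightarrow> real)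
     \<Rightarrow> 'x \<Rightarrow> real \<Rightarrow> ennreal"
  where "posterior_risk f \<pi> L W x a =
    (\<integral>\<^sup>+\<theta>. ennreal (W (L \<theta> x) a) * ennreal (f \<theta> x * \<pi> \<theta>) \<partial>lborel) / marginal f \<pi> x"

definition is_generalized_Bayes ::
  "('t::euclidean_space \<Rightarrow> 'x::topological_space \<Rightarrow> real) \<Rightarrow> ('t \<Rightarrow> real) \<Rightarrow> ('t \<Rightarrow> 'x \<Rightarrow> real)
     \<Rightarrow> (real \<Rightarrow> real \<Rightarrow> real) \<Rightarrow> ('x \<Rightarrow> real) \<Rightarrow> bool"
  where "is_generalized_Bayes f \<pi> L W Lh \<longleftrightarrow>
    estimator Lh \<and>
    (\<forall>x. 0 < marginal f \<pi> x \<and> marginal f \<pi> x < \<top> \<and>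
         posterior_risk f \<pi> L W x (Lh x) < \<top> \<and>
         (\<forall>a>0. posterior_risk f \<pi> L W x (Lh x) \<le> posterior_risk f \<pi> L W x a))"

subsection \<open>The two losses\<close>

definition first_stage_loss ::
  "(real \<Rightarrow> real) \<Rightarrow> real \<Rightarrow> real ^ 'n \<Rightarrow> real ^ 'n \<Rightarrow> real"
  where "first_stage_loss \<beta> \<sigma> \<theta> x = \<beta> ((norm (x - \<theta>))\<^sup>2 / \<sigma>\<^sup>2)"

definition rho :: "real \<Rightarrow> real \<Rightarrow> real" where
  "rho m t = t powr m - m * ln t - 1"

text \<open>\<open>rho m\<close> is nonnegative on the positive reals. The first-stage loss may vanish only at
  \<open>x = \<theta>\<close>, a null set, where the value given by \<open>a / 0 = 0\<close> and \<open>ln 0 = 0\<close> has no effect.\<close>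

definition second_stage_loss :: "real \<Rightarrow> real \<Rightarrow> real \<Rightarrow> real" where
  "second_stage_loss m L Lh = rho m (Lh / L)"

end

theory Submission
  imports Defs
begin

text \<open>
  Both the frequentist risk and the posterior risk under the uniform prior are integrals against a
  Gaussian density of a function of \<open>\<parallel>x - \<theta>\<parallel>\<^sup>2 / \<sigma>\<^sup>2\<close>, and that
  quantity is chi-square distributed whichever of \<open>x\<close> and \<open>\<theta>\<close> is held fixed
  (\<open>nn_integral_mvn_density\<close>). So the constant estimate \<open>a\<close> has risk
  \<open>a powr m * E (\<beta> Z powr - m) - m * ln a - 1 + m * E (ln (\<beta> Z))\<close> at every
  \<open>\<theta>\<close>, and the posterior risk of \<open>a\<close> given any \<open>x\<close> is the same number.
  By \<open>t - 1 - ln t \<ge> 0\<close>, with equality only at \<open>t = 1\<close>, it has a unique minimum at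
  \<open>a powr m * E (\<beta> Z powr - m) = 1\<close>. This determines the generalized Bayes estimator, and
  its constant risk is an upper bound for the minimax risk.

  For the lower bound, fix a level \<open>s\<close> and count only the losses with
  \<open>\<parallel>x - \<theta>\<parallel>\<^sup>2 / \<sigma>\<^sup>2 \<le> s\<close>. The posterior risk restricted to
  them is, for every possible estimate at \<open>x\<close>, at least
  \<open>p * ln (c / p) + m * l\<close>, where \<open>p\<close>, \<open>c\<close>, \<open>l\<close> are the
  probability of \<open>Z \<le> s\<close> and the integrals of \<open>\<beta> Z powr - m\<close> and
  \<open>ln (\<beta> Z)\<close> over that event. The restricted loss only couples \<open>\<theta>\<close> with points
  \<open>x\<close> at bounded distance. Therefore, when the risk is averaged over \<open>\<theta>\<close> in a ball
  of radius \<open>n\<close>, the order of integration can be exchanged with a boundary error whose relative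
  size vanishes as \<open>n\<close> grows (\<open>le_of_local_integral_ge\<close>), and the worst-case risk of any
  estimator is at least that number (\<open>sup_risk_ge_truncated\<close>). As \<open>s\<close> tends to
  infinity it converges to \<open>ln (E (\<beta> Z powr - m)) + m * E (ln (\<beta> Z))\<close>, the risk of the
  generalized Bayes estimator (\<open>sup_risk_ge\<close>).
\<close>

section \<open>The squared norm of a Gaussian vector\<close>

lemma PiM_density_lborel:
  fixes f :: "'i \<Rightarrow> real \<Rightarrow> ennreal"
  assumes "finite I" and f[measurable]: "\<And>i. f i \<in> borel_measurable borel"
    and prob: "\<And>i. prob_space (density lborel (f i))"
  shows "(\<Pi>\<^sub>M i\<in>I. density lborel (f i)) =
    density (\<Pi>\<^sub>M i\<in>I. lborel) (\<lambda>y. \<Prod>i\<in>I. f i (y i))"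
proof -
  interpret F: product_sigma_finite "\<lambda>i. density lborel (f i)"
    by (intro product_sigma_finite.intro prob_space_imp_sigma_finite prob)
  interpret L: product_sigma_finite "\<lambda>i::'i. lborel :: real measure"
    by standard
  show ?thesis
  proof (rule F.PiM_eqI[symmetric, OF \<open>finite I\<close>])
    show "sets (density (\<Pi>\<^sub>M i\<in>I. lborel) (\<lambda>y. \<Prod>i\<in>I. f i (y i)))
        = sets (\<Pi>\<^sub>M i\<in>I. density lborel (f i))"
      unfolding sets_density by (rule sets_PiM_cong) auto
  next
    fix A assume A: "\<And>i. i \<in> I \<Longrightarrow> A i \<in> sets (density lborel (f i))"
    have PiE: "Pi\<^sub>E I A \<in> sets (\<Pi>\<^sub>M i\<in>I. lborel)"
      using A by (intro sets_PiM_I_finite \<open>finite I\<close>) auto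
    have "emeasure (density (\<Pi>\<^sub>M i\<in>I. lborel) (\<lambda>y. \<Prod>i\<in>I. f i (y i))) (Pi\<^sub>E I A)
        = (\<integral>\<^sup>+y. (\<Prod>i\<in>I. f i (y i)) * indicator (Pi\<^sub>E I A) y \<partial>(\<Pi>\<^sub>M i\<in>I. lborel))"
    proof (intro emeasure_density PiE borel_measurable_prod_ennreal)
      fix i assume i: "i \<in> I"
      have "f i \<in> borel_measurable lborel"
        by simp
      from measurable_compose[OF measurable_component_singleton[OF i] this]
      show "(\<lambda>y. f i (y i)) \<in> borel_measurable (\<Pi>\<^sub>M i\<in>I. lborel)" .
    qed
    also have "\<dots> = (\<integral>\<^sup>+y. (\<Prod>i\<in>I. f i (y i) * indicator (A i) (y i)) \<partial>(\<Pi>\<^sub>M i\<in>I. lborel))"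
    proof (rule nn_integral_cong)
      fix y :: "'i \<Rightarrow> real" assume y: "y \<in> space (\<Pi>\<^sub>M i\<in>I. lborel)"
      have "indicator (Pi\<^sub>E I A) y = (\<Prod>i\<in>I. indicator (A i) (y i) :: ennreal)"
        using y \<open>finite I\<close> by (auto simp: indicator_def space_PiM PiE_iff)
      then show "(\<Prod>i\<in>I. f i (y i)) * indicator (Pi\<^sub>E I A) y
          = (\<Prod>i\<in>I. f i (y i) * indicator (A i) (y i))"
        by (simp add: prod.distrib)
    qed
    also have "\<dots> = (\<Prod>i\<in>I. \<integral>\<^sup>+t. f i t * indicator (A i) t \<partial>lborel)"
      using A by (intro L.product_nn_integral_prod \<open>finite I\<close>) auto
    also have "\<dots> = (\<Prod>i\<in>I. emeasure (density lborel (f i)) (A i))"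
      using A by (intro prod.cong refl emeasure_density[symmetric]) auto
    finally show "emeasure (density (\<Pi>\<^sub>M i\<in>I. lborel) (\<lambda>y. \<Prod>i\<in>I. f i (y i))) (Pi\<^sub>E I A)
        = (\<Prod>i\<in>I. emeasure (density lborel (f i)) (A i))" .
  qed
qed

text \<open>
  The product over \<open>{..<d}\<close> is replaced by a product over any index set of size \<open>d\<close>; the
  case needed is the orthonormal basis, over which Lebesgue measure is a product.
\<close>

lemma chi_square_reindex:
  assumes "finite K"
  shows "chi_square (card K) = distr (\<Pi>\<^sub>M k\<in>K. density lborel (\<lambda>t. ennreal (std_normal_density t)))
    borel (\<lambda>y. \<Sum>k\<in>K. (y k)\<^sup>2)"
proof -
  let ?N = "density lborel (\<lambda>t. ennreal (std_normal_density t))"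
  obtain e where e: "bij_betw e {..<card K} K"
    using ex_bij_betw_nat_finite[OF assms] by (auto simp: atLeast0LessThan)
  have "(\<Pi>\<^sub>M i\<in>{..<card K}. ?N)
      = distr (\<Pi>\<^sub>M k\<in>K. ?N) (\<Pi>\<^sub>M i\<in>{..<card K}. ?N) (\<lambda>y. \<lambda>i\<in>{..<card K}. y (e i))"
    using e by (intro distr_PiM_reindex[symmetric, where M = "\<lambda>_. ?N"] prob_space_normal_density)
      (auto simp: bij_betw_def)
  then have "chi_square (card K) = distr (distr (\<Pi>\<^sub>M k\<in>K. ?N) (\<Pi>\<^sub>M i\<in>{..<card K}. ?N)
      (\<lambda>y. \<lambda>i\<in>{..<card K}. y (e i))) borel (\<lambda>y. \<Sum>i<card K. (y i)\<^sup>2)"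
    by (simp add: chi_square_def)
  also have "\<dots> = distr (\<Pi>\<^sub>M k\<in>K. ?N) borel
      ((\<lambda>y. \<Sum>i<card K. (y i)\<^sup>2) \<circ> (\<lambda>y. \<lambda>i\<in>{..<card K}. y (e i)))"
  proof (rule distr_distr)
    show "(\<lambda>y. \<Sum>i<card K. (y i)\<^sup>2) \<in> borel_measurable (\<Pi>\<^sub>M i\<in>{..<card K}. ?N)"
      by measurable
    show "(\<lambda>y. \<lambda>i\<in>{..<card K}. y (e i)) \<in> (\<Pi>\<^sub>M k\<in>K. ?N) \<rightarrow>\<^sub>M (\<Pi>\<^sub>M i\<in>{..<card K}. ?N)"
      using e by (intro measurable_restrict measurable_component_singleton) (auto simp: bij_betw_def)
  qed
  also have "(\<lambda>y. \<Sum>i<card K. (y i)\<^sup>2) \<circ> (\<lambda>y. \<lambda>i\<in>{..<card K}. y (e i))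
      = (\<lambda>y::_ \<Rightarrow> real. \<Sum>k\<in>K. (y k)\<^sup>2)"
    using sum.reindex_bij_betw[OF e] by (auto simp: fun_eq_iff)
  finally show ?thesis .
qed

text \<open>
  The standard Gaussian density is the product of its coordinate densities, so the coordinates in
  the standard basis are independent standard normal variables.
\<close>

lemma chi_square_eq_distr_lborel:
  "chi_square (DIM('a::euclidean_space)) =
    distr (density lborel (\<lambda>x::'a. ennreal (exp (- (norm x)\<^sup>2 / 2) / sqrt (2 * pi) ^ DIM('a))))
      borel (\<lambda>x. (norm x)\<^sup>2)"
proof -
  let ?n = "\<lambda>t. ennreal (std_normal_density t)"
  let ?P = "\<Pi>\<^sub>M b\<in>(Basis :: 'a set). lborel :: real measure"
  let ?T = "\<lambda>y. \<Sum>b\<in>(Basis :: 'a set). y b *\<^sub>R b"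
  let ?g = "\<lambda>x::'a. ennreal (exp (- (norm x)\<^sup>2 / 2) / sqrt (2 * pi) ^ DIM('a))"
  have T[measurable]: "?T \<in> ?P \<rightarrow>\<^sub>M borel" by measurable
  have norm_T: "(norm (?T y))\<^sup>2 = (\<Sum>b\<in>Basis. (y b)\<^sup>2)" for y
    unfolding power2_norm_eq_inner
    by (subst euclidean_inner) (simp add: power2_eq_square)
  have g_T: "?g (?T y) = (\<Prod>b\<in>Basis. ?n (y b))" for y
  proof -
    have "exp (- (norm (?T y))\<^sup>2 / 2) = (\<Prod>b\<in>(Basis :: 'a set). exp (- (y b)\<^sup>2 / 2))"
      unfolding norm_T by (subst exp_sum[symmetric]) (simp_all add: sum_negf sum_divide_distrib)
    then show ?thesis
      by (subst prod_ennreal) (simp_all add: std_normal_density_def prod_dividef)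
  qed
  have "distr (density (lborel :: 'a measure) ?g) borel (\<lambda>x. (norm x)\<^sup>2)
      = distr (density (distr ?P borel ?T) ?g) borel (\<lambda>x. (norm x)\<^sup>2)"
    by (subst (1) lborel_eq) simp
  also have "density (distr ?P borel ?T) ?g = distr (density ?P (\<lambda>y. ?g (?T y))) borel ?T"
    by (rule density_distr) measurable
  also have "density ?P (\<lambda>y. ?g (?T y)) = (\<Pi>\<^sub>M b\<in>(Basis :: 'a set). density lborel ?n)"
    unfolding g_T by (rule PiM_density_lborel[symmetric]) (auto intro: prob_space_normal_density)
  also have "distr (distr (\<Pi>\<^sub>M b\<in>(Basis :: 'a set). density lborel ?n) borel ?T) borel (\<lambda>x. (norm x)\<^sup>2)
      = distr (\<Pi>\<^sub>M b\<in>(Basis :: 'a set). density lborel ?n) borel ((\<lambda>x. (norm x)\<^sup>2) \<circ> ?T)"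
    by (rule distr_distr) measurable
  also have "((\<lambda>x. (norm x)\<^sup>2) \<circ> ?T) = (\<lambda>y. \<Sum>b\<in>Basis. (y b)\<^sup>2)"
    by (simp add: fun_eq_iff norm_T)
  also have "distr (\<Pi>\<^sub>M b\<in>(Basis :: 'a set). density lborel ?n) borel (\<lambda>y. \<Sum>b\<in>Basis. (y b)\<^sup>2)
      = chi_square (DIM('a))"
    by (rule chi_square_reindex[symmetric]) simp
  finally show ?thesis by simp
qed

text \<open>
  The substitution \<open>x = \<theta> + \<sigma> y\<close> turns the density into the standard one, and
  the scaled squared distance to the centre into \<open>\<parallel>y\<parallel>\<^sup>2\<close>. This is the
  only way in which the distribution of the observation is used afterwards.
\<close>

lemma nn_integral_mvn_density:
  fixes \<theta> :: "real ^ 'n"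
  assumes "0 < \<sigma>" and h[measurable]: "h \<in> borel_measurable borel"
  shows "(\<integral>\<^sup>+x. h ((norm (x - \<theta>))\<^sup>2 / \<sigma>\<^sup>2) * ennreal (mvn_density \<sigma> \<theta> x) \<partial>lborel)
    = (\<integral>\<^sup>+z. h z \<partial>chi_square CARD('n))"
proof -
  let ?g = "\<lambda>x::real^'n. ennreal (exp (- (norm x)\<^sup>2 / 2) / sqrt (2 * pi) ^ CARD('n))"
  have [measurable]: "mvn_density \<sigma> \<theta> \<in> borel_measurable borel"
    unfolding mvn_density_def by measurable
  have scale: "ennreal (\<bar>\<sigma>\<bar> ^ CARD('n)) * ennreal (mvn_density \<sigma> \<theta> (\<theta> + \<sigma> *\<^sub>R y)) = ?g y" for y
  proof -
    have "(norm (\<sigma> *\<^sub>R y))\<^sup>2 / (2 * \<sigma>\<^sup>2) = (norm y)\<^sup>2 / 2"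
      using assms by (simp add: power_mult_distrib)
    then have "\<bar>\<sigma>\<bar> ^ CARD('n) * mvn_density \<sigma> \<theta> (\<theta> + \<sigma> *\<^sub>R y)
        = exp (- (norm y)\<^sup>2 / 2) / sqrt (2 * pi) ^ CARD('n)"
      using assms
      by (simp add: mvn_density_def real_sqrt_mult power_mult_distrib)
    then show ?thesis by (simp add: ennreal_mult'[symmetric])
  qed
  have "(\<integral>\<^sup>+x. h ((norm (x - \<theta>))\<^sup>2 / \<sigma>\<^sup>2) * ennreal (mvn_density \<sigma> \<theta> x) \<partial>lborel)
      = (\<integral>\<^sup>+y. ennreal (\<bar>\<sigma>\<bar> ^ CARD('n)) * (h ((norm (\<sigma> *\<^sub>R y))\<^sup>2 / \<sigma>\<^sup>2)
          * ennreal (mvn_density \<sigma> \<theta> (\<theta> + \<sigma> *\<^sub>R y))) \<partial>lborel)"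
    using assms(1)
    by (subst lborel_affine[where c = \<sigma> and t = \<theta>])
       (simp_all add: nn_integral_density nn_integral_distr)
  also have "\<dots> = (\<integral>\<^sup>+y. ?g y * h ((norm y)\<^sup>2) \<partial>lborel)"
    using assms(1) unfolding scale[symmetric]
    by (intro nn_integral_cong) (simp add: power_mult_distrib mult_ac)
  also have "\<dots> = (\<integral>\<^sup>+z. h z \<partial>chi_square (DIM(real^'n)))"
    unfolding chi_square_eq_distr_lborel
    by (simp add: nn_integral_distr nn_integral_density)
  finally show ?thesis by simp
qed

section \<open>Averaging over large balls\<close>

text \<open>
  This replaces the usual sequence of proper priors that approximates the uniform one. Integrate
  \<open>h\<close> over \<open>\<theta>\<close> in a ball of radius \<open>n\<close> and over all \<open>x\<close>. In
  one order of integration, \<open>upper\<close> bounds the result by \<open>S\<close> times the volume of the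
  ball. In the other order, each \<open>x\<close> in the ball of radius \<open>n - r\<close> sees the
  whole of its \<open>r\<close>-neighbourhood and contributes at least \<open>k\<close>. The two volumes have
  ratio tending to one as \<open>n\<close> grows, because \<open>r\<close> stays fixed.
\<close>

lemma le_of_local_integral_ge:
  fixes h :: "'a::euclidean_space \<Rightarrow> 'a \<Rightarrow> ennreal"
  assumes h[measurable]: "case_prod h \<in> borel_measurable (borel \<Otimes>\<^sub>M borel)"
    and "0 \<le> r"
    and lower: "\<And>x. ennreal k \<le> (\<integral>\<^sup>+\<theta>. h \<theta> x * indicator (cball x r) \<theta> \<partial>lborel)"
    and upper: "\<And>\<theta>. (\<integral>\<^sup>+x. h \<theta> x \<partial>lborel) \<le> S"
  shows "ennreal k \<le> S"
proof -
  let ?d = "DIM('a)" and ?v = "unit_ball_vol (real DIM('a))"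
  have v: "0 < ?v" by simp
  then have v0: "?v \<noteq> 0" by linarith
  have bound: "ennreal (k * ((real n - r) / real n) ^ ?d) \<le> S" if n: "r < real n" for n :: nat
  proof -
    have [measurable]: "cball (0::'a) (real n) \<in> sets borel" by simp
    have n0: "0 < real n" using n \<open>0 \<le> r\<close> by linarith
    have "ennreal k * ennreal (?v * (real n - r) ^ ?d)
        = (\<integral>\<^sup>+x. ennreal k * indicator (cball (0::'a) (real n - r)) x \<partial>lborel)"
      using n by (subst nn_integral_cmult_indicator) (simp_all add: emeasure_cball)
    also have "\<dots> \<le> (\<integral>\<^sup>+x. \<integral>\<^sup>+\<theta>. h \<theta> x * indicator (cball 0 (real n)) \<theta> \<partial>lborel \<partial>lborel)"
    proof (rule nn_integral_mono)
      fix x :: 'a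
      show "ennreal k * indicator (cball 0 (real n - r)) x
          \<le> (\<integral>\<^sup>+\<theta>. h \<theta> x * indicator (cball 0 (real n)) \<theta> \<partial>lborel)"
      proof (cases "x \<in> cball 0 (real n - r)")
        case True
        then have "cball x r \<subseteq> cball 0 (real n)"
          by (simp add: cball_subset_cball_iff)
        then have "(\<integral>\<^sup>+\<theta>. h \<theta> x * indicator (cball x r) \<theta> \<partial>lborel)
            \<le> (\<integral>\<^sup>+\<theta>. h \<theta> x * indicator (cball 0 (real n)) \<theta> \<partial>lborel)"
          by (intro nn_integral_mono mult_left_mono) (auto simp: indicator_def)
        with lower[of x] True show ?thesis by (auto intro: order_trans)
      qed simp
    qed
    also have "\<dots> = (\<integral>\<^sup>+\<theta>. \<integral>\<^sup>+x. h \<theta> x * indicator (cball 0 (real n)) \<theta> \<partial>lborel \<partial>lborel)"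
      by (rule lborel_pair.Fubini') measurable
    also have "\<dots> = (\<integral>\<^sup>+\<theta>. (\<integral>\<^sup>+x. h \<theta> x \<partial>lborel) * indicator (cball 0 (real n)) \<theta> \<partial>lborel)"
      by (intro nn_integral_cong nn_integral_multc) measurable
    also have "\<dots> \<le> (\<integral>\<^sup>+\<theta>. S * indicator (cball (0::'a) (real n)) \<theta> \<partial>lborel)"
      by (intro nn_integral_mono mult_right_mono upper) simp
    also have "\<dots> = S * ennreal (?v * real n ^ ?d)"
      by (simp add: nn_integral_cmult emeasure_cball)
    finally have "ennreal k * ennreal (?v * (real n - r) ^ ?d) * ennreal (1 / (?v * real n ^ ?d))
        \<le> S * ennreal (?v * real n ^ ?d) * ennreal (1 / (?v * real n ^ ?d))"
      by (rule mult_right_mono) simp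
    moreover have "ennreal (?v * real n ^ ?d) * ennreal (1 / (?v * real n ^ ?d)) = 1"
      using v0 n0 by (subst ennreal_mult[symmetric]) simp_all
    moreover have "ennreal k * ennreal (?v * (real n - r) ^ ?d) * ennreal (1 / (?v * real n ^ ?d))
        = ennreal (k * ((real n - r) / real n) ^ ?d)"
      using v0 n n0 by (simp add: ennreal_mult''[symmetric] mult.assoc power_divide)
    ultimately show ?thesis by (simp add: mult.assoc)
  qed
  have "(\<lambda>n. (real n - r) / real n) \<longlonglongrightarrow> 1"
    by real_asymp
  then have "(\<lambda>n. ennreal (k * ((real n - r) / real n) ^ ?d)) \<longlonglongrightarrow> ennreal (k * 1 ^ ?d)"
    by (intro tendsto_intros)
  moreover have "eventually (\<lambda>n. r < real n) sequentially"
    by real_asymp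
  then have "eventually (\<lambda>n. ennreal (k * ((real n - r) / real n) ^ ?d) \<le> S) sequentially"
    by (rule eventually_mono) (rule bound)
  ultimately show ?thesis
    using tendsto_upperbound[of _ "ennreal (k * 1 ^ ?d)" sequentially S] by simp
qed

section \<open>The expected loss of a constant estimate\<close>

lemma second_stage_loss_eq:
  assumes "0 < a" "0 < y"
  shows "second_stage_loss m y a = a powr m * y powr (- m) - m * ln a + m * ln y - 1"
  using assms
  by (simp add: second_stage_loss_def rho_def powr_divide powr_minus ln_div field_simps)

text \<open>
  This is \<open>ln u \<le> u - 1\<close> for \<open>u = (a / y) powr m\<close>.
\<close>

lemma second_stage_loss_nonneg:
  assumes "0 < a" "0 < y"
  shows "0 \<le> second_stage_loss m y a"
  using ln_le_minus_one[of "(a / y) powr m"] assms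
  by (simp add: second_stage_loss_def rho_def ln_powr)

text \<open>
  With \<open>t = a powr m * c / p\<close>, the difference of the two sides is
  \<open>p * (t - 1 - ln t)\<close>. The right-hand side is, up to a term without \<open>a\<close>,
  the expected loss of the estimate \<open>a\<close> of \<open>Y\<close> on an event of probability
  \<open>p\<close> over which \<open>Y powr - m\<close> has integral \<open>c\<close>. So the minimum over
  \<open>a\<close> has a closed form and is attained exactly at \<open>t = 1\<close>.
\<close>

lemma tilted_loss_ge:
  fixes a c m p :: real
  assumes "0 < a" "0 < c" "0 < p"
  shows "p * ln (c / p) \<le> a powr m * c - m * ln a * p - p"
    and "p * ln (c / p) = a powr m * c - m * ln a * p - p \<longleftrightarrow> a powr m * c = p"
proof -
  let ?t = "a powr m * c / p"
  have t: "0 < ?t" using assms by simp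
  have ln_t: "ln ?t = m * ln a + ln (c / p)"
    using assms by (simp add: ln_mult ln_div ln_powr)
  have gap: "a powr m * c - m * ln a * p - p - p * ln (c / p) = p * (?t - 1 - ln ?t)"
    unfolding ln_t using assms by (simp add: field_simps)
  have "0 \<le> p * (?t - 1 - ln ?t)"
    using ln_le_minus_one[OF t] assms by simp
  then show "p * ln (c / p) \<le> a powr m * c - m * ln a * p - p"
    unfolding gap[symmetric] by simp
  have "p * ln (c / p) = a powr m * c - m * ln a * p - p \<longleftrightarrow> p * (?t - 1 - ln ?t) = 0"
    unfolding gap[symmetric] by auto
  also have "\<dots> \<longleftrightarrow> ?t = 1"
    using ln_eq_minus_one[OF t] assms by auto
  also have "\<dots> \<longleftrightarrow> a powr m * c = p"
    using assms by auto
  finally show "p * ln (c / p) = a powr m * c - m * ln a * p - p \<longleftrightarrow> a powr m * c = p" .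
qed

text \<open>
  Splitting the power and the logarithm of the quotient makes the expected loss an affine function
  of \<open>a powr m\<close> and \<open>ln a\<close>. The restriction to an event is what the lower bound
  on the minimax risk needs, where only observations near the parameter are kept.
\<close>

lemma (in prob_space) nn_integral_second_stage_loss:
  fixes Y :: "'a \<Rightarrow> real"
  assumes [measurable]: "random_variable borel Y" "A \<in> events"
    and pos: "AE \<omega> in M. 0 < Y \<omega>"
    and int: "integrable M (\<lambda>\<omega>. ln (Y \<omega>))" "integrable M (\<lambda>\<omega>. Y \<omega> powr (- m))"
    and "0 < a"
  defines "G \<equiv> a powr m * (LINT \<omega>:A|M. Y \<omega> powr (- m)) - m * ln a * prob A - prob A
      + m * (LINT \<omega>:A|M. ln (Y \<omega>))"
  shows "(\<integral>\<^sup>+\<omega>. ennreal (second_stage_loss m (Y \<omega>) a) * indicator A \<omega> \<partial>M) = ennreal G"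
    and "0 \<le> G"
proof -
  let ?f = "\<lambda>\<omega>. a powr m * (indicator A \<omega> * Y \<omega> powr (- m)) - m * ln a * indicator A \<omega>
      - indicator A \<omega> + m * (indicator A \<omega> * ln (Y \<omega>))"
  have eq: "AE \<omega> in M. second_stage_loss m (Y \<omega>) a * indicator A \<omega> = ?f \<omega>"
    using pos by eventually_elim (use \<open>0 < a\<close> in \<open>auto simp: second_stage_loss_eq indicator_def\<close>)
  have nn: "AE \<omega> in M. 0 \<le> ?f \<omega>"
    using pos eq by eventually_elim
      (metis \<open>0 < a\<close> second_stage_loss_nonneg indicator_pos_le mult_nonneg_nonneg)
  have ints: "integrable M (\<lambda>\<omega>. indicator A \<omega> * Y \<omega> powr (- m))"
      "integrable M (\<lambda>\<omega>. indicator A \<omega> * ln (Y \<omega>))"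
      "integrable M (indicator A :: 'a \<Rightarrow> real)"
    using integrable_mult_indicator[OF _ int(1), of A] integrable_mult_indicator[OF _ int(2), of A]
    by (simp_all add: integrable_indicator_iff less_top[symmetric])
  have "integral\<^sup>L M ?f = G"
    using ints by (simp add: G_def set_lebesgue_integral_def)
  have "(\<integral>\<^sup>+\<omega>. ennreal (second_stage_loss m (Y \<omega>) a) * indicator A \<omega> \<partial>M) = (\<integral>\<^sup>+\<omega>. ennreal (?f \<omega>) \<partial>M)"
    using eq by (intro nn_integral_cong_AE, eventually_elim)
      (auto simp: indicator_def split: if_splits)
  also have "\<dots> = ennreal (integral\<^sup>L M ?f)"
    using ints nn by (intro nn_integral_eq_integral) auto
  finally show "(\<integral>\<^sup>+\<omega>. ennreal (second_stage_loss m (Y \<omega>) a) * indicator A \<omega> \<partial>M) = ennreal G"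
    unfolding \<open>integral\<^sup>L M ?f = G\<close> .
  show "0 \<le> G"
    unfolding \<open>integral\<^sup>L M ?f = G\<close>[symmetric] using nn by (rule integral_nonneg_AE)
qed

section \<open>Gaussian observations\<close>

lemma mvn_density_commute: "mvn_density \<sigma> \<theta> x = mvn_density \<sigma> x \<theta>"
  by (simp add: mvn_density_def norm_minus_commute)

lemma measurable_mvn_density[measurable]:
  "(\<lambda>(\<theta>, x). mvn_density \<sigma> \<theta> x) \<in> borel_measurable (borel \<Otimes>\<^sub>M borel)"
  unfolding mvn_density_def by measurable

lemma measurable_second_stage_loss[measurable]:
  assumes [measurable]: "f \<in> borel_measurable N" "g \<in> borel_measurable N"
  shows "(\<lambda>x. second_stage_loss m (f x) (g x)) \<in> borel_measurable N"
  unfolding second_stage_loss_def rho_def by measurable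

text \<open>
  A loss function given on the half-line has to be extended measurably to the line before it fits
  here. The parameter \<open>dim\<close> carries the dimension of the observation space.
\<close>

locale gaussian_loss_estimation = prob_space M
  for M :: "'z measure" +
  fixes \<beta> :: "real \<Rightarrow> real" and \<sigma> m :: real and Z :: "'z \<Rightarrow> real" and dim :: "'n::finite itself"
  assumes \<sigma>_pos: "0 < \<sigma>"
    and m_nonzero: "m \<noteq> 0"
    and \<beta>_meas[measurable]: "\<beta> \<in> borel_measurable borel"
    and \<beta>_pos: "\<And>t. 0 < t \<Longrightarrow> 0 < \<beta> t"
    and Z_meas[measurable]: "random_variable borel Z"
    and Z_law: "distr M borel Z = chi_square CARD('n)"
    and int_ln: "integrable M (\<lambda>\<omega>. ln (\<beta> (Z \<omega>)))"
    and int_powr: "integrable M (\<lambda>\<omega>. \<beta> (Z \<omega>) powr (- m))"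
begin

definition inverse_moment :: real where "inverse_moment = expectation (\<lambda>\<omega>. \<beta> (Z \<omega>) powr (- m))"

definition opt :: real where "opt = inverse_moment powr (- 1 / m)"

text \<open>
  The least expected loss on an event \<open>A\<close> of positive probability among all constant
  estimates, in the closed form given by \<open>tilted_loss_ge\<close>. On the whole space it is the minimax risk.
\<close>

definition value_on :: "'z set \<Rightarrow> real" where
  "value_on A = prob A * ln ((LINT \<omega>:A|M. \<beta> (Z \<omega>) powr (- m)) / prob A)
     + m * (LINT \<omega>:A|M. ln (\<beta> (Z \<omega>)))"

lemma nn_integral_mvn_density_eq:
  assumes [measurable]: "h \<in> borel_measurable borel"
  shows "(\<integral>\<^sup>+x. h ((norm (x - \<theta>))\<^sup>2 / \<sigma>\<^sup>2) * ennreal (mvn_density \<sigma> (\<theta> :: real ^ 'n) x) \<partial>lborel)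
    = (\<integral>\<^sup>+\<omega>. h (Z \<omega>) \<partial>M)"
  by (simp add: nn_integral_mvn_density[OF \<sigma>_pos assms] Z_law[symmetric] nn_integral_distr)

text \<open>
  The event \<open>Z \<le> 0\<close> has the probability that the Gaussian vector hits its own centre,
  which is a single point. Thus a value \<open>\<beta> 0 = 0\<close> of the loss is harmless.
\<close>

lemma AE_Z_pos: "AE \<omega> in M. 0 < Z \<omega>"
proof -
  have "emeasure M {\<omega> \<in> space M. Z \<omega> \<le> 0}
      = (\<integral>\<^sup>+\<omega>. indicator {\<omega> \<in> space M. Z \<omega> \<le> 0} \<omega> \<partial>M)"
    by (rule nn_integral_indicator[symmetric]) measurable
  also have "\<dots> = (\<integral>\<^sup>+\<omega>. indicator {..0} (Z \<omega>) \<partial>M)"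
    by (intro nn_integral_cong) (simp add: indicator_def)
  also have "\<dots> = (\<integral>\<^sup>+x. indicator {..0} ((norm (x - 0))\<^sup>2 / \<sigma>\<^sup>2)
      * ennreal (mvn_density \<sigma> (0 :: real ^ 'n) x) \<partial>lborel)"
    by (rule nn_integral_mvn_density_eq[symmetric]) simp
  also have "\<dots> = (\<integral>\<^sup>+x. 0 \<partial>(lborel :: (real ^ 'n) measure))"
  proof (rule nn_integral_cong_AE)
    show "AE x in lborel. indicator {..0} ((norm (x - 0))\<^sup>2 / \<sigma>\<^sup>2)
        * ennreal (mvn_density \<sigma> (0 :: real ^ 'n) x) = 0"
      using AE_lborel_singleton[of "0 :: real ^ 'n"]
    proof eventually_elim
      case (elim x)
      then have "0 < (norm x)\<^sup>2 / \<sigma>\<^sup>2" using \<sigma>_pos by simp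
      then show ?case by (simp add: indicator_def)
    qed
  qed
  finally have "emeasure M {\<omega> \<in> space M. Z \<omega> \<le> 0} = 0" by simp
  then show ?thesis
    by (intro AE_I[where N = "{\<omega> \<in> space M. Z \<omega> \<le> 0}"]) (auto simp: not_less)
qed

lemma AE_\<beta>_pos: "AE \<omega> in M. 0 < \<beta> (Z \<omega>)"
  using AE_Z_pos by eventually_elim (rule \<beta>_pos)

lemma inverse_moment_pos: "0 < inverse_moment"
proof -
  have "AE \<omega> in M. 0 < \<beta> (Z \<omega>) powr (- m)"
    using AE_\<beta>_pos by eventually_elim simp
  from expectation_greater[OF int_powr this] show ?thesis
    by (simp add: inverse_moment_def)
qed

text \<open>
  The value \<open>G\<close> depends neither on \<open>\<theta>\<close> nor on the roles of the two arguments
  of the density, so this is at once a frequentist risk and, under the uniform prior, a posterior risk, both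
  restricted to the scaled squared distances in \<open>K\<close>.
\<close>

lemma truncated_loss:
  assumes K[measurable]: "K \<in> sets borel" and "0 < a"
  defines "A \<equiv> {\<omega> \<in> space M. Z \<omega> \<in> K}"
  defines "G \<equiv> a powr m * (LINT \<omega>:A|M. \<beta> (Z \<omega>) powr (- m)) - m * ln a * prob A - prob A
      + m * (LINT \<omega>:A|M. ln (\<beta> (Z \<omega>)))"
  shows "(\<integral>\<^sup>+x. ennreal (second_stage_loss m (first_stage_loss \<beta> \<sigma> \<theta> x) a)
      * indicator K ((norm (x - \<theta>))\<^sup>2 / \<sigma>\<^sup>2) * ennreal (mvn_density \<sigma> (\<theta> :: real ^ 'n) x) \<partial>lborel)
    = ennreal G"
    and "0 \<le> G"
proof -
  have [measurable]: "A \<in> events" unfolding A_def by measurable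
  note loss = nn_integral_second_stage_loss[OF _ \<open>A \<in> events\<close> AE_\<beta>_pos int_ln int_powr \<open>0 < a\<close>]
  have "(\<integral>\<^sup>+x. ennreal (second_stage_loss m (first_stage_loss \<beta> \<sigma> \<theta> x) a)
      * indicator K ((norm (x - \<theta>))\<^sup>2 / \<sigma>\<^sup>2) * ennreal (mvn_density \<sigma> (\<theta> :: real ^ 'n) x) \<partial>lborel)
      = (\<integral>\<^sup>+\<omega>. ennreal (second_stage_loss m (\<beta> (Z \<omega>)) a) * indicator K (Z \<omega>) \<partial>M)"
    unfolding first_stage_loss_def
    by (rule nn_integral_mvn_density_eq[where
          h = "\<lambda>z. ennreal (second_stage_loss m (\<beta> z) a) * indicator K z"]) measurable
  also have "\<dots> = (\<integral>\<^sup>+\<omega>. ennreal (second_stage_loss m (\<beta> (Z \<omega>)) a) * indicator A \<omega> \<partial>M)"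
    by (intro nn_integral_cong) (auto simp: A_def indicator_def)
  also have "\<dots> = ennreal G"
    unfolding G_def by (rule loss) measurable
  finally show "(\<integral>\<^sup>+x. ennreal (second_stage_loss m (first_stage_loss \<beta> \<sigma> \<theta> x) a)
      * indicator K ((norm (x - \<theta>))\<^sup>2 / \<sigma>\<^sup>2) * ennreal (mvn_density \<sigma> (\<theta> :: real ^ 'n) x) \<partial>lborel)
    = ennreal G" .
  show "0 \<le> G"
    unfolding G_def by (rule loss) measurable
qed

lemma full_loss:
  assumes "0 < a"
  defines "G \<equiv> a powr m * inverse_moment - m * ln a - 1 + m * expectation (\<lambda>\<omega>. ln (\<beta> (Z \<omega>)))"
  shows "(\<integral>\<^sup>+x. ennreal (second_stage_loss m (first_stage_loss \<beta> \<sigma> \<theta> x) a)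
      * ennreal (mvn_density \<sigma> (\<theta> :: real ^ 'n) x) \<partial>lborel) = ennreal G"
    and "0 \<le> G"
    and "value_on (space M) \<le> G"
    and "value_on (space M) = G \<longleftrightarrow> a = opt"
proof -
  show "(\<integral>\<^sup>+x. ennreal (second_stage_loss m (first_stage_loss \<beta> \<sigma> \<theta> x) a)
      * ennreal (mvn_density \<sigma> (\<theta> :: real ^ 'n) x) \<partial>lborel) = ennreal G"
    and "0 \<le> G"
    using truncated_loss[of UNIV, OF _ \<open>0 < a\<close>]
    by (simp_all add: G_def inverse_moment_def prob_space set_integral_space int_ln int_powr)
  have V: "value_on (space M) = 1 * ln (inverse_moment / 1) + m * expectation (\<lambda>\<omega>. ln (\<beta> (Z \<omega>)))"
    by (simp add: value_on_def prob_space inverse_moment_def set_integral_space int_ln int_powr)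
  show "value_on (space M) \<le> G"
    unfolding V G_def using tilted_loss_ge(1)[OF \<open>0 < a\<close> inverse_moment_pos, of 1 m] by simp
  have "value_on (space M) = G \<longleftrightarrow> a powr m * inverse_moment = 1"
    unfolding V G_def using tilted_loss_ge(2)[OF \<open>0 < a\<close> inverse_moment_pos, of 1 m] by simp
  also have "\<dots> \<longleftrightarrow> m * ln a = - ln inverse_moment"
    using \<open>0 < a\<close> inverse_moment_pos ln_inj_iff[of "a powr m * inverse_moment" 1] by (simp add: ln_mult ln_powr) linarith
  also have "\<dots> \<longleftrightarrow> ln a = ln opt"
    using inverse_moment_pos m_nonzero by (simp add: opt_def ln_powr field_simps)
  also have "\<dots> \<longleftrightarrow> a = opt"
    using \<open>0 < a\<close> inverse_moment_pos by (intro ln_inj_iff) (simp_all add: opt_def)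
  finally show "value_on (space M) = G \<longleftrightarrow> a = opt" .
qed

lemma opt_pos: "0 < opt"
  using inverse_moment_pos by (simp add: opt_def)

lemma value_nonneg: "0 \<le> value_on (space M)"
  using full_loss(2,4)[OF opt_pos] by simp

lemma value_eq: "value_on (space M) = m * expectation (\<lambda>\<omega>. ln (\<beta> (Z \<omega>))) + ln inverse_moment"
  by (simp add: value_on_def prob_space inverse_moment_def set_integral_space int_ln int_powr)

lemma loss_opt:
  "(\<integral>\<^sup>+x. ennreal (second_stage_loss m (first_stage_loss \<beta> \<sigma> \<theta> x) opt)
      * ennreal (mvn_density \<sigma> (\<theta> :: real ^ 'n) x) \<partial>lborel) = ennreal (value_on (space M))"
  using full_loss(1,4)[OF opt_pos] by simp

lemma loss_le_imp_opt:
  assumes "0 < a"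
    and "(\<integral>\<^sup>+x. ennreal (second_stage_loss m (first_stage_loss \<beta> \<sigma> \<theta> x) a)
      * ennreal (mvn_density \<sigma> (\<theta> :: real ^ 'n) x) \<partial>lborel) \<le> ennreal (value_on (space M))"
  shows "a = opt"
  using assms(2) full_loss[OF assms(1)] value_nonneg by (auto simp: ennreal_le_iff)

lemma loss_ge:
  assumes "0 < a"
  shows "ennreal (value_on (space M))
    \<le> (\<integral>\<^sup>+x. ennreal (second_stage_loss m (first_stage_loss \<beta> \<sigma> \<theta> x) a)
      * ennreal (mvn_density \<sigma> (\<theta> :: real ^ 'n) x) \<partial>lborel)"
  using full_loss[OF assms] by (simp add: ennreal_leI)

section \<open>The generalized Bayes estimator\<close>

lemma marginal_eq: "marginal (mvn_density \<sigma>) (\<lambda>\<theta>. 1) (x :: real ^ 'n) = 1"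
  using nn_integral_mvn_density_eq[of "\<lambda>_. 1" x]
  by (simp add: marginal_def mvn_density_commute[of _ _ x] emeasure_space_1)

text \<open>
  Since the density is symmetric, the posterior under the uniform prior is the Gaussian law centred
  at the observation.
\<close>

lemma posterior_risk_eq:
  "posterior_risk (mvn_density \<sigma>) (\<lambda>\<theta>. 1) (first_stage_loss \<beta> \<sigma>) (second_stage_loss m) (x :: real ^ 'n) a
    = (\<integral>\<^sup>+\<theta>. ennreal (second_stage_loss m (first_stage_loss \<beta> \<sigma> x \<theta>) a)
        * ennreal (mvn_density \<sigma> x \<theta>) \<partial>lborel)"
  by (simp add: posterior_risk_def marginal_eq mvn_density_commute[of _ _ x]
      first_stage_loss_def norm_minus_commute divide_ennreal_def)

lemma generalized_Bayes_iff:
  fixes Lh :: "real ^ 'n \<Rightarrow> real"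
  shows "is_generalized_Bayes (mvn_density \<sigma>) (\<lambda>\<theta>. 1) (first_stage_loss \<beta> \<sigma>) (second_stage_loss m) Lh
    \<longleftrightarrow> Lh = (\<lambda>_. opt)"
proof -
  let ?post = "\<lambda>x :: real ^ 'n. posterior_risk (mvn_density \<sigma>) (\<lambda>\<theta>. 1)
    (first_stage_loss \<beta> \<sigma>) (second_stage_loss m) x"
  have post_opt: "?post x opt = ennreal (value_on (space M))" for x
    unfolding posterior_risk_eq by (rule loss_opt)
  have post_ge: "ennreal (value_on (space M)) \<le> ?post x a" if "0 < a" for x a
    unfolding posterior_risk_eq by (rule loss_ge[OF that])
  have post_le: "a = opt" if "0 < a" "?post x a \<le> ennreal (value_on (space M))" for x a
    using that unfolding posterior_risk_eq by (rule loss_le_imp_opt)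
  show ?thesis
  proof
    assume "is_generalized_Bayes (mvn_density \<sigma>) (\<lambda>\<theta>. 1) (first_stage_loss \<beta> \<sigma>) (second_stage_loss m) Lh"
    then have "0 < Lh x" "?post x (Lh x) \<le> ?post x opt" for x
      using opt_pos unfolding is_generalized_Bayes_def estimator_def by blast+
    then show "Lh = (\<lambda>_. opt)"
      unfolding post_opt by (intro ext post_le)
  next
    assume "Lh = (\<lambda>_. opt)"
    then show "is_generalized_Bayes (mvn_density \<sigma>) (\<lambda>\<theta>. 1) (first_stage_loss \<beta> \<sigma>) (second_stage_loss m) Lh"
      unfolding is_generalized_Bayes_def marginal_eq
      by (simp add: post_opt post_ge estimator_def opt_pos)
  qed
qed

section \<open>The lower bound for the worst-case risk\<close>

lemma risk_eq:
  fixes Lh :: "real ^ 'n \<Rightarrow> real"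
  assumes "estimator Lh"
  shows "risk (mvn \<sigma>) (first_stage_loss \<beta> \<sigma>) (second_stage_loss m) \<theta> Lh
    = (\<integral>\<^sup>+x. ennreal (second_stage_loss m (first_stage_loss \<beta> \<sigma> \<theta> x) (Lh x))
        * ennreal (mvn_density \<sigma> \<theta> x) \<partial>lborel)"
proof -
  have [measurable]: "Lh \<in> borel_measurable borel" using assms by (simp add: estimator_def)
  show ?thesis
    unfolding risk_def mvn_def first_stage_loss_def
    by (subst nn_integral_density) (auto simp: mult.commute)
qed

text \<open>
  For fixed \<open>x\<close>, restricting \<open>\<theta>\<close> to the ball of radius
  \<open>\<sigma> * sqrt s\<close> around \<open>x\<close> restricts the chi-square variable to values at most
  \<open>s\<close>. Whatever number \<open>Lh x\<close> is, the restricted posterior risk is at least the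
  value of that event, and \<open>le_of_local_integral_ge\<close> applies.
\<close>

lemma sup_risk_ge_truncated:
  fixes Lh :: "real ^ 'n \<Rightarrow> real"
  assumes Lh: "estimator Lh" and "0 \<le> s"
  defines "A \<equiv> {\<omega> \<in> space M. Z \<omega> \<in> {..s}}"
  assumes pos: "0 < prob A" "0 < (LINT \<omega>:A|M. \<beta> (Z \<omega>) powr (- m))"
  shows "ennreal (value_on A) \<le> (SUP \<theta>. risk (mvn \<sigma>) (first_stage_loss \<beta> \<sigma>) (second_stage_loss m) \<theta> Lh)"
  \<comment> \<open>The radius is the one for which \<open>dist x \<theta> \<le> r\<close> means that the scaled squared distance is
    at most \<open>s\<close>.\<close>
proof (rule le_of_local_integral_ge)
  let ?h = "\<lambda>\<theta> x. ennreal (second_stage_loss m (first_stage_loss \<beta> \<sigma> \<theta> x) (Lh x))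
        * ennreal (mvn_density \<sigma> \<theta> x)"
  have [measurable]: "Lh \<in> borel_measurable borel" using Lh by (simp add: estimator_def)
  show "case_prod ?h \<in> borel_measurable (borel \<Otimes>\<^sub>M borel)"
    unfolding first_stage_loss_def by measurable
  show "0 \<le> \<sigma> * sqrt s"
    using \<sigma>_pos \<open>0 \<le> s\<close> by simp
  show "(\<integral>\<^sup>+x. ?h \<theta> x \<partial>lborel)
      \<le> (SUP \<theta>. risk (mvn \<sigma>) (first_stage_loss \<beta> \<sigma>) (second_stage_loss m) \<theta> Lh)" for \<theta>
    unfolding risk_eq[OF Lh, symmetric] by (rule SUP_upper) simp
  show "ennreal (value_on A) \<le> (\<integral>\<^sup>+\<theta>. ?h \<theta> x * indicator (cball x (\<sigma> * sqrt s)) \<theta> \<partial>lborel)" for x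
  proof -
    have a: "0 < Lh x" using Lh by (simp add: estimator_def)
    have ball: "\<theta> \<in> cball x (\<sigma> * sqrt s) \<longleftrightarrow> (norm (\<theta> - x))\<^sup>2 / \<sigma>\<^sup>2 \<in> {..s}" for \<theta>
    proof -
      have "\<theta> \<in> cball x (\<sigma> * sqrt s) \<longleftrightarrow> norm (\<theta> - x) / \<sigma> \<le> sqrt s"
        using \<sigma>_pos by (simp add: dist_norm norm_minus_commute field_simps)
      also have "\<dots> \<longleftrightarrow> (norm (\<theta> - x) / \<sigma>)\<^sup>2 \<le> (sqrt s)\<^sup>2"
        using \<sigma>_pos \<open>0 \<le> s\<close> abs_le_square_iff[of "norm (\<theta> - x) / \<sigma>" "sqrt s"] by simp
      finally show ?thesis using \<open>0 \<le> s\<close> by (simp add: power_divide)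
    qed
    have "value_on A \<le> Lh x powr m * (LINT \<omega>:A|M. \<beta> (Z \<omega>) powr (- m)) - m * ln (Lh x) * prob A
        - prob A + m * (LINT \<omega>:A|M. ln (\<beta> (Z \<omega>)))"
      unfolding value_on_def using tilted_loss_ge(1)[OF a pos(2,1), of m] by simp
    then have "ennreal (value_on A) \<le> ennreal (Lh x powr m * (LINT \<omega>:A|M. \<beta> (Z \<omega>) powr (- m))
        - m * ln (Lh x) * prob A - prob A + m * (LINT \<omega>:A|M. ln (\<beta> (Z \<omega>))))"
      by (rule ennreal_leI)
    also have "\<dots> = (\<integral>\<^sup>+\<theta>. ennreal (second_stage_loss m (first_stage_loss \<beta> \<sigma> x \<theta>) (Lh x))
      * indicator {..s} ((norm (\<theta> - x))\<^sup>2 / \<sigma>\<^sup>2) * ennreal (mvn_density \<sigma> x \<theta>) \<partial>lborel)"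
      unfolding A_def by (rule truncated_loss(1)[symmetric, OF _ a]) simp
    also have "\<dots> = (\<integral>\<^sup>+\<theta>. ?h \<theta> x * indicator (cball x (\<sigma> * sqrt s)) \<theta> \<partial>lborel)"
    proof (rule nn_integral_cong)
      fix \<theta> :: "real ^ 'n"
      have "indicator (cball x (\<sigma> * sqrt s)) \<theta> = (indicator {..s} ((norm (\<theta> - x))\<^sup>2 / \<sigma>\<^sup>2) :: ennreal)"
        using ball[of \<theta>] by (simp only: indicator_def)
      moreover have "first_stage_loss \<beta> \<sigma> x \<theta> = first_stage_loss \<beta> \<sigma> \<theta> x"
        by (simp add: first_stage_loss_def norm_minus_commute)
      ultimately show "ennreal (second_stage_loss m (first_stage_loss \<beta> \<sigma> x \<theta>) (Lh x))
          * indicator {..s} ((norm (\<theta> - x))\<^sup>2 / \<sigma>\<^sup>2) * ennreal (mvn_density \<sigma> x \<theta>)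
          = ?h \<theta> x * indicator (cball x (\<sigma> * sqrt s)) \<theta>"
        by (simp only: mvn_density_commute[of \<sigma> x \<theta>] mult_ac)
    qed
    finally show ?thesis .
  qed
qed

text \<open>
  The truncation level tends to infinity.
\<close>

lemma sup_risk_ge:
  fixes Lh :: "real ^ 'n \<Rightarrow> real"
  assumes Lh: "estimator Lh"
  shows "ennreal (value_on (space M))
    \<le> (SUP \<theta>. risk (mvn \<sigma>) (first_stage_loss \<beta> \<sigma>) (second_stage_loss m) \<theta> Lh)"
proof -
  define A where "A n = {\<omega> \<in> space M. Z \<omega> \<in> {..real n}}" for n :: nat
  have A_sets: "A n \<in> events" for n unfolding A_def by measurable
  have A_mono: "incseq A" by (auto simp: incseq_def A_def)
  have A_Un: "(\<Union>n. A n) = space M"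
    by (auto simp: A_def intro: real_arch_simple)
  have lim: "(\<lambda>n. LINT \<omega>:A n|M. f \<omega>) \<longlonglongrightarrow> expectation f" if "integrable M f" for f :: "'z \<Rightarrow> real"
  proof -
    have "set_integrable M (\<Union>n. A n) f"
      unfolding A_Un set_integrable_def using that integrable_mult_indicator[OF sets.top that] by simp
    from set_integral_cont_up[OF A_sets A_mono this] show ?thesis
      unfolding A_Un set_integral_space[OF that] .
  qed
  have lim_p: "(\<lambda>n. prob (A n)) \<longlonglongrightarrow> 1"
    using finite_Lim_measure_incseq[OF _ A_mono] A_sets by (auto simp: A_Un prob_space image_subset_iff)
  have lim_moment: "(\<lambda>n. LINT \<omega>:A n|M. \<beta> (Z \<omega>) powr (- m)) \<longlonglongrightarrow> inverse_moment"
    unfolding inverse_moment_def by (rule lim[OF int_powr])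
  have "(\<lambda>n. value_on (A n)) \<longlonglongrightarrow> 1 * ln (inverse_moment / 1) + m * expectation (\<lambda>\<omega>. ln (\<beta> (Z \<omega>)))"
    unfolding value_on_def using inverse_moment_pos
    by (intro tendsto_intros lim_p lim_moment lim int_ln) auto
  then have "(\<lambda>n. ennreal (value_on (A n))) \<longlonglongrightarrow> ennreal (value_on (space M))"
    by (intro tendsto_ennrealI) (simp add: value_eq add.commute)
  moreover have "eventually (\<lambda>n. ennreal (value_on (A n))
      \<le> (SUP \<theta>. risk (mvn \<sigma>) (first_stage_loss \<beta> \<sigma>) (second_stage_loss m) \<theta> Lh)) sequentially"
    using order_tendstoD(1)[OF lim_p zero_less_one] order_tendstoD(1)[OF lim_moment inverse_moment_pos]
    by eventually_elim (unfold A_def, rule sup_risk_ge_truncated[OF Lh], simp_all)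
  ultimately show ?thesis
    by (rule tendsto_upperbound) simp
qed

lemma estimator_opt: "estimator (\<lambda>_ :: real ^ 'n. opt)"
  by (simp add: estimator_def opt_pos)

lemma sup_risk_opt:
  "(SUP \<theta> :: real ^ 'n. risk (mvn \<sigma>) (first_stage_loss \<beta> \<sigma>) (second_stage_loss m) \<theta> (\<lambda>_. opt))
    = ennreal (value_on (space M))"
  by (simp add: risk_eq[OF estimator_opt] loss_opt)

lemma minimax_risk_eq:
  "minimax_risk (mvn \<sigma> :: real ^ 'n \<Rightarrow> _) (first_stage_loss \<beta> \<sigma>) (second_stage_loss m)
    = ennreal (value_on (space M))"
  unfolding minimax_risk_def
proof (rule antisym)
  show "(INF Lh\<in>{Lh. estimator Lh}. SUP \<theta> :: real ^ 'n.
      risk (mvn \<sigma>) (first_stage_loss \<beta> \<sigma>) (second_stage_loss m) \<theta> Lh) \<le> ennreal (value_on (space M))"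
    unfolding sup_risk_opt[symmetric] by (rule INF_lower) (simp add: estimator_opt)
  show "ennreal (value_on (space M)) \<le> (INF Lh\<in>{Lh. estimator Lh}. SUP \<theta> :: real ^ 'n.
      risk (mvn \<sigma>) (first_stage_loss \<beta> \<sigma>) (second_stage_loss m) \<theta> Lh)"
    by (rule INF_greatest) (simp add: sup_risk_ge)
qed

end

section \<open>The minimax estimator\<close>

theorem theorem4:
  fixes \<beta> :: "real \<Rightarrow> real" and \<sigma> m :: real
    and M :: "'z measure" and Z :: "'z \<Rightarrow> real"
    and Lhat0 :: "real ^ 'n \<Rightarrow> real"
  assumes "0 < \<sigma>"
    and "\<And>t. 0 \<le> t \<Longrightarrow> 0 \<le> \<beta> t"
    and "abs_cont_halfline \<beta>"
    and "strict_mono_on {0..} \<beta>"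
    and "m \<noteq> 0"
    and "prob_space M"
    and "Z \<in> borel_measurable M"
    and "distr M borel Z = chi_square CARD('n)"
    and "integrable M (\<lambda>\<omega>. \<beta> (Z \<omega>))"
    and "integrable M (\<lambda>\<omega>. ln (\<beta> (Z \<omega>)))"
    and "integrable M (\<lambda>\<omega>. \<beta> (Z \<omega>) powr (- m))"
  defines "Lhat0 \<equiv> \<lambda>x. (\<integral>\<omega>. \<beta> (Z \<omega>) powr (- m) \<partial>M) powr (- 1 / m)"
  shows "(\<forall>Lh. is_generalized_Bayes (mvn_density \<sigma>) (\<lambda>\<theta>. 1)
               (first_stage_loss \<beta> \<sigma>) (second_stage_loss m) Lh \<longleftrightarrow> Lh = Lhat0)
    \<and> is_minimax (mvn \<sigma>) (first_stage_loss \<beta> \<sigma>) (second_stage_loss m) Lhat0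
    \<and> enn2ereal (minimax_risk (mvn \<sigma> :: real ^ 'n \<Rightarrow> _) (first_stage_loss \<beta> \<sigma>) (second_stage_loss m))
        = ereal (m * (\<integral>\<omega>. ln (\<beta> (Z \<omega>)) \<partial>M) + ln (\<integral>\<omega>. \<beta> (Z \<omega>) powr (- m) \<partial>M))"
proof -
  \<comment> \<open>On the negative half-line \<open>\<beta>\<close> is arbitrary and possibly not measurable, so it is replaced
    there by a constant.\<close>
  define b where "b t = \<beta> (max 0 t)" for t
  interpret prob_space M by fact
  have "mono b"
    using strict_mono_on_imp_mono_on[OF \<open>strict_mono_on {0..} \<beta>\<close>]
    by (auto simp: b_def mono_def mono_on_def)
  then have b_meas[measurable]: "b \<in> borel_measurable borel"
    by (rule borel_measurable_mono)
  have b_pos: "0 < b t" if "0 < t" for t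
    using strict_mono_onD[OF \<open>strict_mono_on {0..} \<beta>\<close>, of 0 t] assms(2)[of 0] that
    by (simp add: b_def)
  have loss_b: "first_stage_loss b \<sigma> = (first_stage_loss \<beta> \<sigma> :: real ^ 'n \<Rightarrow> _)"
    by (simp add: first_stage_loss_def b_def fun_eq_iff)
  have Z_nonneg: "AE \<omega> in M. 0 \<le> Z \<omega>"
  proof -
    have "AE z in chi_square CARD('n). 0 \<le> z"
      unfolding chi_square_def by (subst AE_distr_iff) (simp_all add: sum_nonneg)
    then show ?thesis
      unfolding \<open>distr M borel Z = chi_square CARD('n)\<close>[symmetric]
      using \<open>Z \<in> borel_measurable M\<close> by (subst (asm) AE_distr_iff) auto
  qed
  then have b_Z: "AE \<omega> in M. \<beta> (Z \<omega>) = b (Z \<omega>)"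
    by eventually_elim (simp add: b_def)
  note [measurable] = \<open>Z \<in> borel_measurable M\<close>
  note [measurable] = borel_measurable_integrable[OF assms(10)] borel_measurable_integrable[OF assms(11)]
  have ln_eq: "AE \<omega> in M. ln (\<beta> (Z \<omega>)) = ln (b (Z \<omega>))"
    and powr_eq: "AE \<omega> in M. \<beta> (Z \<omega>) powr (- m) = b (Z \<omega>) powr (- m)"
    using b_Z by (eventually_elim, simp)+
  have int: "integrable M (\<lambda>\<omega>. ln (b (Z \<omega>)))" "integrable M (\<lambda>\<omega>. b (Z \<omega>) powr (- m))"
    using assms(10) integrable_cong_AE[OF _ _ ln_eq] assms(11) integrable_cong_AE[OF _ _ powr_eq]
    by simp_all
  have int_eq: "expectation (\<lambda>\<omega>. ln (\<beta> (Z \<omega>))) = expectation (\<lambda>\<omega>. ln (b (Z \<omega>)))"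
    "expectation (\<lambda>\<omega>. \<beta> (Z \<omega>) powr (- m)) = expectation (\<lambda>\<omega>. b (Z \<omega>) powr (- m))"
    using integral_cong_AE[OF _ _ ln_eq] integral_cong_AE[OF _ _ powr_eq] by simp_all
  interpret gaussian_loss_estimation M b \<sigma> m Z "TYPE('n)"
    by unfold_locales (use assms b_pos int in auto)
  have Lhat0: "Lhat0 = (\<lambda>_. opt)"
    by (simp add: Lhat0_def opt_def inverse_moment_def int_eq)
  show ?thesis
    unfolding loss_b[symmetric] Lhat0 int_eq
    using generalized_Bayes_iff sup_risk_opt estimator_opt value_nonneg
    by (simp add: is_minimax_def minimax_risk_eq value_eq inverse_moment_def)
qed

end
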